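(* Let $(s,\eta):\Sigma\to\mathcal{Q}$ be an isothermic net with edge-labelling $m$. For $t\in\mathbb{R}$ (different from every $m_{ij}$) define, for each oriented edge from $i$ to $j$, $$\Gamma^s(t)_{ji}=\begin{cases}\Gamma_{s_i}^{s_j}(1-t/m_{ij}) & \text{if } m_{ij}\neq\infty,\\ \exp(t\eta_{ji})&\text{if } m_{ij}=\infty,\end{cases}$$ a connection on the trivial bundle $\Sigma\times\mathbb{R}^{p+1,q+1}$. Then each $\Gamma^s(t)$ is a flat connection: on each quadrilateral with cyclically ordered vertices $i,j,k,\ell$, $$\Gamma^s(t)_{kj}\Gamma^s(t)_{ji}=\Gamma^s(t)_{k\ell}\Gamma^s(t)_{\ell i}.$$
   Context: Domain: $\Sigma\subset\mathbb{Z}^N$; an edge $ij$ is a pair of points of $\Sigma$ differing by a standard unit vector; a quadrilateral is an elementary square with all four vertices $i,j,k,\ell$ (in cyclic order) in $\Sigma$. A vector-valued $1$-form $\alpha$ assigns $\alpha_{ji}=-\alpha_{ij}$ to each oriented edge from $i$ to $j$; it is closed if $\alpha_{i\ell}+\alpha_{\ell k}+\alpha_{kj}+\alpha_{ji}=0$ on every quadrilateral. $\mathbb{R}^{p+1,q+1}$ has a non-degenerate symmetric bilinear form $(\cdot,\cdot)$ of signature $(p+1,q+1)$; $\mathcal{L}$ is its light cone and $\mathcal{Q}=\mathbb{P}(\mathcal{L})$. The Lie algebra $\mathfrak{o}(p+1,q+1)$ is identified with $\Lambda^2\mathbb{R}^{p+1,q+1}$ via $(a\wedge b)(z)=(a,z)b-(b,z)a$.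 A map $s:\Sigma\to\mathcal{Q}$ is viewed as a null line subbundle. It is required to be regular: on each quadrilateral $s_i,s_j,s_k,s_\ell$ are pairwise distinct, $\dim(s_i+s_j+s_k+s_\ell)\ge3$, and $s_i\not\perp s_k$, $s_j\not\perp s_\ell$. An isothermic net $(s,\eta)$ is a regular $s$ with a closed, never-zero $\Lambda^2\mathbb{R}^{p+1,q+1}$-valued $1$-form $\eta$ such that $\eta_{ji}\in s_j\wedge s_i$ on each edge. Edge-labelling: on an edge write $\eta_{ji}=\mu_j\wedge\mu_i$ with $\mu_i\in s_i$, $\mu_j\in s_j$ (e.g. for a Moutard lift $\mu$ of $s$) and set $m_{ij}=1/(\mu_i,\mu_j)\in\mathbb{R}^\times\cup\{\infty\}$; this depends only on $\eta_{ji}$. For non-orthogonal null lines $s_i,s_j$ and $\lambda\in\mathbb{R}^\times$, $\Gamma_{s_i}^{s_j}(\lambda)\in \mathrm{O}(p+1,q+1)$ is the map acting as $\lambda$ on $s_j$, as $1$ on $(s_i\oplus s_j)^\perp$ and as $1/\lambda$ on $s_i$. *)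

theory Defs
  imports "HOL-Analysis.Analysis"
begin

section \<open>The domain\<close>

definition unit_step :: "(int ^ 'n) \<Rightarrow> bool" where
  "unit_step u \<longleftrightarrow> (\<exists>a. u = axis a 1 \<or> u = - axis a 1)"

text \<open>Edges are oriented: both \<open>(i, j)\<close> and \<open>(j, i)\<close> satisfy the predicate.\<close>

definition edge :: "(int ^ 'n) set \<Rightarrow> int ^ 'n \<Rightarrow> int ^ 'n \<Rightarrow> bool" where
  "edge S i j \<longleftrightarrow> i \<in> S \<and> j \<in> S \<and> unit_step (j - i)"

text \<open>All eight cyclic labellings \<open>i, j, k, l\<close> of an elementary square (four starting
  vertices, two directions) satisfy the predicate.\<close>

definition quad :: "(int ^ 'n) set \<Rightarrow> int ^ 'n \<Rightarrow> int ^ 'n \<Rightarrow> int ^ 'n \<Rightarrow> int ^ 'n \<Rightarrow> bool" where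
  "quad S i j k l \<longleftrightarrow> i \<in> S \<and> j \<in> S \<and> k \<in> S \<and> l \<in> S \<and>
     (\<exists>u v. unit_step u \<and> unit_step v \<and> u \<noteq> v \<and> u \<noteq> - v \<and>
        j = i + u \<and> k = i + u + v \<and> l = i + v)"

text \<open>The value \<open>\<alpha> j i\<close> is attached to the oriented edge from \<open>i\<close> to \<open>j\<close>; values
  at pairs that are not edges are irrelevant.\<close>

definition one_form :: "(int ^ 'n) set \<Rightarrow> (int ^ 'n \<Rightarrow> int ^ 'n \<Rightarrow> 'v::real_vector) \<Rightarrow> bool" where
  "one_form S \<alpha> \<longleftrightarrow> (\<forall>i j. edge S i j \<longrightarrow> \<alpha> j i = - \<alpha> i j)"

definition closed_form :: "(int ^ 'n) set \<Rightarrow> (int ^ 'n \<Rightarrow> int ^ 'n \<Rightarrow> 'v::real_vector) \<Rightarrow> bool" where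
  "closed_form S \<alpha> \<longleftrightarrow>
     (\<forall>i j k l. quad S i j k l \<longrightarrow> \<alpha> i l + \<alpha> l k + \<alpha> k j + \<alpha> j i = 0)"


section \<open>Pseudo-Euclidean space\<close>

text \<open>The inner product of the Euclidean type \<open>'a\<close> plays no role beyond fixing the topology;
  the geometry is that of the form \<open>B\<close>. The family \<open>e\<close> is automatically linearly independent,
  so \<open>DIM('a) = p + q\<close>.\<close>

definition form_of_signature :: "('a::euclidean_space \<Rightarrow> 'a \<Rightarrow> real) \<Rightarrow> nat \<Rightarrow> nat \<Rightarrow> bool" where
  "form_of_signature B p q \<longleftrightarrow>
     bilinear B \<and> (\<forall>x y. B x y = B y x) \<and> (\<forall>x. (\<forall>y. B x y = 0) \<longrightarrow> x = 0) \<and>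
     (\<exists>e :: nat \<Rightarrow> 'a. span (e ` {..<p + q}) = UNIV \<and>
        (\<forall>a<p + q. \<forall>b<p + q. B (e a) (e b) = (if a = b then (if a < p then 1 else - 1) else 0)))"

definition light_cone :: "('a::euclidean_space \<Rightarrow> 'a \<Rightarrow> real) \<Rightarrow> 'a set" where
  "light_cone B = {v. B v v = 0}"

definition quadric :: "('a::euclidean_space \<Rightarrow> 'a \<Rightarrow> real) \<Rightarrow> 'a set set" where
  "quadric B = {span {v} | v. v \<in> light_cone B \<and> v \<noteq> 0}"

definition orth :: "('a::euclidean_space \<Rightarrow> 'a \<Rightarrow> real) \<Rightarrow> 'a set \<Rightarrow> 'a set \<Rightarrow> bool" where
  "orth B U V \<longleftrightarrow> (\<forall>x\<in>U. \<forall>y\<in>V. B x y = 0)"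

text \<open>Bivectors are identified with skew endomorphisms by
  \<open>(a \<and> b)(z) = (a, z) b - (b, z) a\<close>.\<close>

definition wedge :: "('a::euclidean_space \<Rightarrow> 'a \<Rightarrow> real) \<Rightarrow> 'a \<Rightarrow> 'a \<Rightarrow> 'a \<Rightarrow>\<^sub>L 'a" where
  "wedge B a b = Blinfun (\<lambda>z. B a z *\<^sub>R b - B b z *\<^sub>R a)"

definition wedge_space :: "('a::euclidean_space \<Rightarrow> 'a \<Rightarrow> real) \<Rightarrow> 'a set \<Rightarrow> 'a set \<Rightarrow> ('a \<Rightarrow>\<^sub>L 'a) set" where
  "wedge_space B U V = span {wedge B a b | a b. a \<in> U \<and> b \<in> V}"

lemma blinfun_apply_wedge:
  assumes "bilinear B"
  shows "blinfun_apply (wedge B a b) z = B a z *\<^sub>R b - B b z *\<^sub>R a"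
proof -
  have "linear (\<lambda>z. B a z *\<^sub>R b - B b z *\<^sub>R a)"
    using assms unfolding bilinear_def
    by (intro linearI) (auto simp: linear_add linear_cmul algebra_simps)
  then show ?thesis
    unfolding wedge_def by (simp add: bounded_linear_Blinfun_apply linear_conv_bounded_linear)
qed


section \<open>Isothermic nets\<close>

definition regular_net :: "('a::euclidean_space \<Rightarrow> 'a \<Rightarrow> real) \<Rightarrow> (int ^ 'n) set \<Rightarrow>
    (int ^ 'n \<Rightarrow> 'a set) \<Rightarrow> bool" where
  "regular_net B S s \<longleftrightarrow>
     (\<forall>i\<in>S. s i \<in> quadric B) \<and>
     (\<forall>i j k l. quad S i j k l \<longrightarrow>
        distinct [s i, s j, s k, s l] \<and>
        dim (span (s i \<union> s j \<union> s k \<union> s l)) \<ge> 3 \<and>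
        \<not> orth B (s i) (s k) \<and> \<not> orth B (s j) (s l))"

definition isothermic_net :: "('a::euclidean_space \<Rightarrow> 'a \<Rightarrow> real) \<Rightarrow> (int ^ 'n) set \<Rightarrow>
    (int ^ 'n \<Rightarrow> 'a set) \<Rightarrow> (int ^ 'n \<Rightarrow> int ^ 'n \<Rightarrow> 'a \<Rightarrow>\<^sub>L 'a) \<Rightarrow> bool" where
  "isothermic_net B S s \<eta> \<longleftrightarrow>
     regular_net B S s \<and> one_form S \<eta> \<and> closed_form S \<eta> \<and>
     (\<forall>i j. edge S i j \<longrightarrow> \<eta> j i \<noteq> 0 \<and> \<eta> j i \<in> wedge_space B (s j) (s i))"

text \<open>Division in \<open>ereal\<close> satisfies \<open>1 / 0 = \<infinity>\<close>, so the label is \<open>\<infinity>\<close> exactly when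
  \<open>s i\<close> and \<open>s j\<close> are orthogonal.\<close>

definition edge_labelling :: "('a::euclidean_space \<Rightarrow> 'a \<Rightarrow> real) \<Rightarrow> (int ^ 'n) set \<Rightarrow>
    (int ^ 'n \<Rightarrow> 'a set) \<Rightarrow> (int ^ 'n \<Rightarrow> int ^ 'n \<Rightarrow> 'a \<Rightarrow>\<^sub>L 'a) \<Rightarrow>
    (int ^ 'n \<Rightarrow> int ^ 'n \<Rightarrow> ereal) \<Rightarrow> bool" where
  "edge_labelling B S s \<eta> m \<longleftrightarrow>
     (\<forall>i j. edge S i j \<longrightarrow>
        (\<exists>\<mu>i\<in>s i. \<exists>\<mu>j\<in>s j. \<eta> j i = wedge B \<mu>j \<mu>i \<and> m i j = 1 / ereal (B \<mu>i \<mu>j)))"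

text \<open>The label depends only on the bivector, and every isothermic net has a labelling.\<close>

lemma wedge_scale:
  assumes "bilinear B"
  shows "wedge B (x *\<^sub>R a) (y *\<^sub>R b) = (x * y) *\<^sub>R wedge B a b"
proof (rule blinfun_eqI)
  fix z
  show "blinfun_apply (wedge B (x *\<^sub>R a) (y *\<^sub>R b)) z = blinfun_apply ((x * y) *\<^sub>R wedge B a b) z"
    by (simp add: blinfun_apply_wedge[OF assms] blinfun.scaleR_left bilinear_lmul[OF assms]
        algebra_simps)
qed

lemma edge_label_unique:
  assumes B: "bilinear B" and U: "U \<in> quadric B" and V: "V \<in> quadric B"
    and "a \<in> U" "a' \<in> U" "b \<in> V" "b' \<in> V"
    and eq: "wedge B b a = wedge B b' a'" and nz: "wedge B b a \<noteq> 0"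
  shows "B a b = B a' b'"
proof -
  obtain u v where "U = span {u}" "V = span {v}"
    using U V unfolding quadric_def by blast
  then obtain x x' y y' where *: "a = x *\<^sub>R u" "a' = x' *\<^sub>R u" "b = y *\<^sub>R v" "b' = y' *\<^sub>R v"
    using assms by (auto simp: span_singleton)
  have "y * x = y' * x'"
    using eq nz unfolding * wedge_scale[OF B] by auto
  then show ?thesis
    unfolding * by (simp add: bilinear_lmul[OF B] bilinear_rmul[OF B] mult.commute)
qed

lemma edge_labelling_exists:
  assumes B: "bilinear B" and net: "isothermic_net B S s \<eta>"
  shows "\<exists>m. edge_labelling B S s \<eta> m"
proof -
  have "\<exists>c. \<exists>\<mu>i\<in>s i. \<exists>\<mu>j\<in>s j. \<eta> j i = wedge B \<mu>j \<mu>i \<and> c = 1 / ereal (B \<mu>i \<mu>j)"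
    if e: "edge S i j" for i j
  proof -
    have mem: "\<eta> j i \<in> wedge_space B (s j) (s i)" and "s i \<in> quadric B" "s j \<in> quadric B"
      using net e unfolding isothermic_net_def regular_net_def edge_def by auto
    then obtain u v where uv: "s i = span {u}" "s j = span {v}"
      unfolding quadric_def by blast
    have "{wedge B a b | a b. a \<in> s j \<and> b \<in> s i} \<subseteq> span {wedge B v u}"
      unfolding uv by (auto simp: span_singleton wedge_scale[OF B])
    then have "\<eta> j i \<in> span {wedge B v u}"
      using mem unfolding wedge_space_def by (meson span_minimal subspace_span subsetD)
    then obtain c where "\<eta> j i = c *\<^sub>R wedge B v u"
      by (auto simp: span_singleton)
    then have "\<eta> j i = wedge B (c *\<^sub>R v) u"
      using wedge_scale[OF B, of c v 1 u] by simp
    moreover have "u \<in> s i" "c *\<^sub>R v \<in> s j"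
      unfolding uv by (auto simp: span_base span_scale)
    ultimately show ?thesis
      by blast
  qed
  then show ?thesis
    unfolding edge_labelling_def by metis
qed


section \<open>The connections\<close>

text \<open>\<open>null_dilation B L L' r\<close> is the map written \<open>\<Gamma>\<close> with lower index \<open>L\<close>, upper index \<open>L'\<close> and
  argument \<open>r\<close>.\<close>

definition is_null_dilation :: "('a::euclidean_space \<Rightarrow> 'a \<Rightarrow> real) \<Rightarrow> 'a set \<Rightarrow> 'a set \<Rightarrow> real \<Rightarrow>
    ('a \<Rightarrow>\<^sub>L 'a) \<Rightarrow> bool" where
  "is_null_dilation B L L' r f \<longleftrightarrow>
     (\<forall>x\<in>L'. blinfun_apply f x = r *\<^sub>R x) \<and>
     (\<forall>x. (\<forall>y\<in>span (L \<union> L'). B x y = 0) \<longrightarrow> blinfun_apply f x = x) \<and>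
     (\<forall>x\<in>L. blinfun_apply f x = (1 / r) *\<^sub>R x)"

definition null_dilation :: "('a::euclidean_space \<Rightarrow> 'a \<Rightarrow> real) \<Rightarrow> 'a set \<Rightarrow> 'a set \<Rightarrow> real \<Rightarrow> 'a \<Rightarrow>\<^sub>L 'a" where
  "null_dilation B L L' r = (THE f. is_null_dilation B L L' r f)"

lemma null_dilation_unique:
  assumes B: "bilinear B" and sym: "\<And>x y. B x y = B y x"
    and L: "L \<in> quadric B" and L': "L' \<in> quadric B" and no: "\<not> orth B L L'"
  shows "\<exists>!f. is_null_dilation B L L' r f"
proof -
  obtain u v0 where u: "L = span {u}" "B u u = 0" and v0: "L' = span {v0}" "B v0 v0 = 0"
    using L L' unfolding quadric_def light_cone_def by blast
  have nz: "B u v0 \<noteq> 0"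
    using no unfolding orth_def u v0
    by (auto simp: span_singleton bilinear_lmul[OF B] bilinear_rmul[OF B])
  define v where "v = (1 / B u v0) *\<^sub>R v0"
  have uv: "B u v = 1" "B v v = 0" "B v u = 1"
    using nz v0 sym[of v0 u] by (simp_all add: v_def bilinear_lmul[OF B] bilinear_rmul[OF B])
  have v: "L' = span {v}"
  proof -
    have "v0 = B u v0 *\<^sub>R v" using nz by (simp add: v_def)
    then have "v0 \<in> span {v}" unfolding span_singleton by blast
    moreover have "v \<in> span {v0}" unfolding v_def span_singleton by blast
    ultimately show ?thesis
      unfolding v0(1) by (intro equalityI span_minimal subspace_span) auto
  qed
  note lin = bilinear_lmul[OF B] bilinear_rmul[OF B] bilinear_ladd[OF B] bilinear_radd[OF B]
    bilinear_lsub[OF B] bilinear_rsub[OF B]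
  define P where "P x = x - B x v *\<^sub>R u - B x u *\<^sub>R v" for x
  have P: "B (P x) y = 0" if "y \<in> span (L \<union> L')" for x y
    using that
  proof (induction rule: span_induct)
    case base
    show ?case
      by (rule subspaceI) (auto simp: lin bilinear_rzero[OF B])
  next
    case (step y)
    then show ?case
      by (auto simp: u(1) v span_singleton P_def lin u(2) uv)
  qed
  define f where "f x = P x + (r * B x u) *\<^sub>R v + (B x v / r) *\<^sub>R u" for x
  have "linear f"
    unfolding f_def P_def by (rule linearI) (auto simp: lin algebra_simps add_divide_distrib)
  then have bf: "blinfun_apply (Blinfun f) = f"
    by (intro ext) (simp add: bounded_linear_Blinfun_apply linear_conv_bounded_linear)
  have "is_null_dilation B L L' r (Blinfun f)"
    unfolding is_null_dilation_def bf
  proof (intro conjI allI impI ballI)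
    fix x assume "x \<in> L'"
    then show "f x = r *\<^sub>R x"
      by (auto simp: v span_singleton f_def P_def lin uv)
  next
    fix x assume "x \<in> L"
    then show "f x = (1 / r) *\<^sub>R x"
      by (auto simp: u(1) span_singleton f_def P_def lin uv u(2))
  next
    fix x assume *: "\<forall>y\<in>span (L \<union> L'). B x y = 0"
    have "B x u = 0" "B x v = 0"
      using * by (auto simp: u(1) v span_base)
    then show "f x = x"
      by (simp add: f_def P_def)
  qed
  moreover have "g = h" if g: "is_null_dilation B L L' r g" and h: "is_null_dilation B L L' r h" for g h
  proof (rule blinfun_eqI)
    fix x
    have x: "x = P x + B x v *\<^sub>R u + B x u *\<^sub>R v"
      by (simp add: P_def)
    have mem: "u \<in> L" "v \<in> L'"
      by (auto simp: u(1) v span_base)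
    have "blinfun_apply k (P x + B x v *\<^sub>R u + B x u *\<^sub>R v)
        = P x + B x v *\<^sub>R ((1 / r) *\<^sub>R u) + B x u *\<^sub>R (r *\<^sub>R v)"
      if "is_null_dilation B L L' r k" for k
      using that P[of _ x] mem unfolding is_null_dilation_def
      by (simp add: blinfun.add_right blinfun.scaleR_right)
    from this[OF g] this[OF h] show "blinfun_apply g x = blinfun_apply h x"
      using x by metis
  qed
  ultimately show ?thesis by blast
qed

text \<open>The library's \<open>exp\<close> needs a normed algebra type, which \<open>'a \<Rightarrow>\<^sub>L 'a\<close> is not an
  instance of.\<close>

definition blinfun_exp :: "('a::euclidean_space \<Rightarrow>\<^sub>L 'a) \<Rightarrow> 'a \<Rightarrow>\<^sub>L 'a" where
  "blinfun_exp A = (\<Sum>n. (1 / fact n) *\<^sub>R (((o\<^sub>L) A ^^ n) id_blinfun))"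

definition isothermic_connection :: "('a::euclidean_space \<Rightarrow> 'a \<Rightarrow> real) \<Rightarrow> (int ^ 'n \<Rightarrow> 'a set) \<Rightarrow>
    (int ^ 'n \<Rightarrow> int ^ 'n \<Rightarrow> 'a \<Rightarrow>\<^sub>L 'a) \<Rightarrow> (int ^ 'n \<Rightarrow> int ^ 'n \<Rightarrow> ereal) \<Rightarrow> real \<Rightarrow>
    int ^ 'n \<Rightarrow> int ^ 'n \<Rightarrow> 'a \<Rightarrow>\<^sub>L 'a" where
  "isothermic_connection B s \<eta> m t j i =
     (if m i j \<noteq> \<infinity> then null_dilation B (s i) (s j) (1 - t / real_of_ereal (m i j))
      else blinfun_exp (t *\<^sub>R \<eta> j i))"

text \<open>A connection on the trivial bundle: \<open>\<Gamma> j i\<close> is a linear isomorphism from the fibre at \<open>i\<close>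
  to the fibre at \<open>j\<close>, with inverse \<open>\<Gamma> i j\<close>. Since \<open>edge\<close> is symmetric in \<open>i\<close> and \<open>j\<close>,
  the one-sided identity below gives both.\<close>

definition connection :: "(int ^ 'n) set \<Rightarrow> (int ^ 'n \<Rightarrow> int ^ 'n \<Rightarrow> 'a::euclidean_space \<Rightarrow>\<^sub>L 'a) \<Rightarrow> bool" where
  "connection S \<Gamma> \<longleftrightarrow> (\<forall>i j. edge S i j \<longrightarrow> \<Gamma> i j o\<^sub>L \<Gamma> j i = id_blinfun)"

definition flat_connection :: "(int ^ 'n) set \<Rightarrow> (int ^ 'n \<Rightarrow> int ^ 'n \<Rightarrow> 'a::euclidean_space \<Rightarrow>\<^sub>L 'a) \<Rightarrow> bool" where
  "flat_connection S \<Gamma> \<longleftrightarrow> connection S \<Gamma> \<and>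
     (\<forall>i j k l. quad S i j k l \<longrightarrow> \<Gamma> k j o\<^sub>L \<Gamma> j i = \<Gamma> k l o\<^sub>L \<Gamma> l i)"

end

theory Submission
  imports Defs
begin

text \<open>
  On an edge write \<open>\<eta> j i = wedge B b a\<close> with \<open>a \<in> s i\<close> and \<open>b \<in> s j\<close>. Whether the label of the
  edge is finite or not, the connection is given by one and the same formula,
  \<open>x \<mapsto> x - t (a, x) b + t / (1 - t (a, b)) (b, x) a\<close>:
  for \<open>(a, b) \<noteq> 0\<close> this has the three eigenspaces of the null dilation, and for \<open>(a, b) = 0\<close> it is
  \<open>id + t \<eta>\<close>, which is the exponential because then \<open>\<eta>\<close> squares to zero
  (\<open>isothermic_connection_apply\<close>).

  On a quadrilateral, closedness of \<open>\<eta>\<close> says that two decomposable bivectors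
  \<open>v\<^sub>j \<and> (\<alpha> v\<^sub>i - \<beta> v\<^sub>k)\<close> and \<open>v\<^sub>l \<and> (\<delta> v\<^sub>i - \<gamma> v\<^sub>k)\<close> agree. They then span the same plane, and
  regularity, which forbids that all four lines lie in that plane, forces the two combinations of
  \<open>v\<^sub>i\<close> and \<open>v\<^sub>k\<close> to be proportional. After rescaling one gets a Moutard lift: vectors \<open>a, b, c, d\<close>
  on the four lines that represent \<open>\<eta>\<close> on all four edges and satisfy
  \<open>b - d = \<kappa> (a - c)\<close> (\<open>moutard_lift\<close>).

  Here \<open>\<kappa> \<noteq> 0\<close> because \<open>s j\<close> and \<open>s l\<close> differ. Since the four vectors are null, the equation then
  gives \<open>(a, b) = (c, d)\<close>, \<open>(b, c) = (a, d)\<close> and \<open>(b, c) - (a, b) = \<kappa> (a, c)\<close>: opposite edges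
  have equal labels. The composition along \<open>i, j, k\<close> differs from the identity by an explicit
  combination of \<open>a - c\<close> and \<open>b\<close>; the one along \<open>i, l, k\<close> is the same expression with
  \<open>d = b - \<kappa> (a - c)\<close> in place of \<open>b\<close> and the two labels exchanged. The three relations identify
  the coefficients (\<open>edge_transport_flat\<close>).
\<close>

section \<open>Transport along an edge\<close>

text \<open>The common form of the dilation with factor \<open>1 - t * B a b\<close> on the line of \<open>b\<close> and, for
  orthogonal \<open>a\<close> and \<open>b\<close>, of the exponential of \<open>t *\<^sub>R wedge B b a\<close>.\<close>

definition edge_transport :: "('a::euclidean_space \<Rightarrow> 'a \<Rightarrow> real) \<Rightarrow> real \<Rightarrow> 'a \<Rightarrow> 'a \<Rightarrow> 'a \<Rightarrow> 'a" where
  "edge_transport B t a b x = x - (t * B a x) *\<^sub>R b + (t / (1 - t * B a b) * B b x) *\<^sub>R a"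

locale symmetric_bilinear_form =
  fixes B :: "'a::euclidean_space \<Rightarrow> 'a \<Rightarrow> real"
  assumes bilin: "bilinear B" and sym: "B x y = B y x"
begin

lemmas form_simps = bilinear_lmul[OF bilin] bilinear_rmul[OF bilin] bilinear_ladd[OF bilin]
  bilinear_radd[OF bilin] bilinear_lsub[OF bilin] bilinear_rsub[OF bilin]
  bilinear_lzero[OF bilin] bilinear_rzero[OF bilin]

lemma linear_edge_transport: "linear (edge_transport B t a b)"
  unfolding edge_transport_def
  by (rule linearI) (auto simp: form_simps algebra_simps add_divide_distrib)

lemma blinfun_apply_edge_transport:
  "blinfun_apply (Blinfun (edge_transport B t a b)) = edge_transport B t a b"
  using linear_edge_transport by (simp add: bounded_linear_Blinfun_apply linear_conv_bounded_linear)

lemma edge_transport_inverse: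
  assumes "B a a = 0" "B b b = 0" "1 - t * B a b \<noteq> 0"
  shows "edge_transport B t b a (edge_transport B t a b x) = x"
proof -
  define p where "p = 1 / (1 - t * B a b)"
  have p: "p * (t * B a b) = p - 1"
    using assms(3) by (simp add: p_def field_simps)
  let ?y = "edge_transport B t a b x"
  have y: "?y = x - (t * B a x) *\<^sub>R b + (t * p * B b x) *\<^sub>R a"
    by (simp add: edge_transport_def p_def)
  have "B b ?y = B b x + p * (t * B a b) * B b x"
    unfolding y by (simp add: form_simps assms sym[of b a])
  also have "\<dots> = p * B b x"
    unfolding p by (simp add: algebra_simps)
  finally have b: "B b ?y = p * B b x" .
  have "p * B a ?y = p * B a x - p * (t * B a b) * B a x"
    unfolding y by (simp add: form_simps assms algebra_simps)
  also have "\<dots> = B a x"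
    unfolding p by (simp add: algebra_simps)
  finally have a: "p * B a ?y = B a x" .
  have "edge_transport B t b a ?y = ?y - (t * B b ?y) *\<^sub>R a + (t * (p * B a ?y)) *\<^sub>R b"
    by (simp add: edge_transport_def[of B t b a ?y] p_def sym[of b a])
  also have "\<dots> = x"
    unfolding a b unfolding y by (simp add: algebra_simps)
  finally show ?thesis .
qed

text \<open>The expression is arranged so that \<open>b\<close>, which is what distinguishes the two paths around a
  quadrilateral, enters only through \<open>B b x\<close>, the two labels and one vector summand.\<close>

lemma edge_transport_compose:
  assumes "B b b = 0" "1 - t * B a b \<noteq> 0" "1 - t * B b c \<noteq> 0"
    and p: "p = 1 / (1 - t * B a b)" and q: "q = 1 / (1 - t * B b c)"
  shows "edge_transport B t b c (edge_transport B t a b x) =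
    x + (t * p * B b x) *\<^sub>R (a - c) + (t * q * (B c x - B a x + t * p * B a c * B b x)) *\<^sub>R b"
proof -
  have p': "p * (t * B a b) = p - 1" and q': "q * (t * B b c) = q - 1"
    using assms by (simp_all add: field_simps)
  let ?y = "edge_transport B t a b x"
  have y: "?y = x - (t * B a x) *\<^sub>R b + (t * p * B b x) *\<^sub>R a"
    by (simp add: edge_transport_def p)
  have "B b ?y = B b x + p * (t * B a b) * B b x"
    unfolding y by (simp add: form_simps assms(1) sym[of b a])
  also have "\<dots> = p * B b x"
    unfolding p' by (simp add: algebra_simps)
  finally have b: "B b ?y = p * B b x" .
  have "q * B c ?y = q * (B c x + t * p * B a c * B b x) - q * (t * B b c) * B a x"
    unfolding y by (simp add: form_simps sym[of c] algebra_simps)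
  also have "\<dots> = q * (B c x - B a x + t * p * B a c * B b x) + B a x"
    unfolding q' by (simp add: algebra_simps)
  finally have c: "q * B c ?y = q * (B c x - B a x + t * p * B a c * B b x) + B a x" .
  have "edge_transport B t b c ?y = ?y - (t * B b ?y) *\<^sub>R c + (t * (q * B c ?y)) *\<^sub>R b"
    by (simp add: edge_transport_def[of B t b c ?y] q)
  also have "\<dots> = ?y - (t * (p * B b x)) *\<^sub>R c
      + (t * (q * (B c x - B a x + t * p * B a c * B b x) + B a x)) *\<^sub>R b"
    unfolding b c by (simp add: algebra_simps)
  also have "\<dots> = x + (t * p * B b x) *\<^sub>R (a - c)
      + (t * q * (B c x - B a x + t * p * B a c * B b x)) *\<^sub>R b"
    unfolding y by (simp only: scaleR_add_left scaleR_diff_right distrib_left mult.assoc) simp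
  finally show ?thesis .
qed

text \<open>The hypothesis \<open>b - d = \<kappa> *\<^sub>R (a - c)\<close> is the Moutard equation. If \<open>\<kappa> = 0\<close>, the two paths
  coincide. Otherwise nullity of \<open>d\<close> determines the product of \<open>b\<close> with \<open>a - c\<close>, and the labels on
  the path through \<open>d\<close> turn out to be those on the path through \<open>b\<close> in the opposite order.\<close>

lemma edge_transport_flat:
  assumes null: "B a a = 0" "B b b = 0" "B c c = 0" "B d d = 0"
    and moutard: "b - d = \<kappa> *\<^sub>R (a - c)"
    and ab: "1 - t * B a b \<noteq> 0" and bc: "1 - t * B b c \<noteq> 0"
  shows "edge_transport B t b c (edge_transport B t a b x)
       = edge_transport B t d c (edge_transport B t a d x)"
proof (cases "\<kappa> = 0")
  case True
  then show ?thesis using moutard by simp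
next
  case False
  define w where "w = a - c"
  have d: "d = b - \<kappa> *\<^sub>R w"
    using moutard by (simp add: w_def algebra_simps)
  have ww: "B w w = - 2 * B a c"
    by (simp add: w_def form_simps null sym[of c a])
  have "B d d = \<kappa> * (\<kappa> * B w w - 2 * B b w)"
    by (simp add: d form_simps null sym[of w b] algebra_simps)
  then have bw: "B b w = - \<kappa> * B a c"
    using null(4) False ww by simp
  then have diff: "B b c - B a b = \<kappa> * B a c"
    by (simp add: w_def form_simps sym[of b a])
  have aw: "B a w = - B a c" and wc: "B w c = B a c"
    by (simp_all add: w_def form_simps null)
  have ad: "B a d = B b c"
    using diff by (simp add: d form_simps aw algebra_simps)
  have dc: "B d c = B a b"
    using diff by (simp add: d form_simps wc algebra_simps)
  define p where "p = 1 / (1 - t * B a b)"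
  define q where "q = 1 / (1 - t * B b c)"
  have "p - q = p * (q * (1 - t * B b c)) - q * (p * (1 - t * B a b))"
    using ab bc by (simp add: p_def q_def)
  also have "\<dots> = - t * p * q * (B b c - B a b)"
    by (simp add: algebra_simps)
  finally have pq: "p - q = - t * p * q * (\<kappa> * B a c)"
    unfolding diff .
  let ?X = "B b x" and ?W = "B w x"
  have W: "B c x - B a x = - ?W"
    by (simp add: w_def form_simps)
  have dx: "B d x = ?X - \<kappa> * ?W"
    by (simp add: d form_simps)
  \<comment> \<open>Both sides are expanded in \<open>w = a - c\<close> and \<open>b\<close>; the coefficients agree by the relation \<open>pq\<close>.\<close>
  have coeff_b: "q * (- ?W + t * p * B a c * ?X)
      = p * (- ?W + t * q * B a c * (?X - \<kappa> * ?W))"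
  proof -
    have "q * (- ?W + t * p * B a c * ?X) - p * (- ?W + t * q * B a c * (?X - \<kappa> * ?W))
        = ?W * ((p - q) + t * p * q * (\<kappa> * B a c))"
      by (simp add: algebra_simps)
    then show ?thesis by (simp add: pq)
  qed
  have coeff_w: "p * ?X = q * (?X - \<kappa> * ?W) - \<kappa> * (p * (- ?W + t * q * B a c * (?X - \<kappa> * ?W)))"
  proof -
    have "p * ?X - (q * (?X - \<kappa> * ?W) - \<kappa> * (p * (- ?W + t * q * B a c * (?X - \<kappa> * ?W))))
        = (?X - \<kappa> * ?W) * ((p - q) + t * p * q * (\<kappa> * B a c))"
      by (simp add: algebra_simps)
    then show ?thesis by (simp add: pq)
  qed
  have "edge_transport B t b c (edge_transport B t a b x)
      = x + (t * (p * ?X)) *\<^sub>R w + (t * (q * (- ?W + t * p * B a c * ?X))) *\<^sub>R b"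
    using edge_transport_compose[OF null(2) ab bc p_def q_def, of x]
    unfolding W w_def[symmetric] by (simp add: mult.assoc)
  also have "\<dots> = x + (t * (q * (?X - \<kappa> * ?W))) *\<^sub>R w
      + (t * (p * (- ?W + t * q * B a c * (?X - \<kappa> * ?W)))) *\<^sub>R (b - \<kappa> *\<^sub>R w)"
    unfolding coeff_w coeff_b by (simp add: algebra_simps)
  also have "\<dots> = edge_transport B t d c (edge_transport B t a d x)"
    using edge_transport_compose[OF null(4), of t a c q p x] ab bc
    unfolding ad dc W dx w_def[symmetric] d[symmetric] by (simp add: mult.assoc p_def q_def)
  finally show ?thesis .
qed


section \<open>The connection in terms of the form\<close>

lemma null_dilation_eq_edge_transport:
  assumes quad: "span {a} \<in> quadric B" "span {b} \<in> quadric B"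
    and null: "B a a = 0" "B b b = 0" and ab: "B a b \<noteq> 0" and r: "1 - t * B a b \<noteq> 0"
  shows "null_dilation B (span {a}) (span {b}) (1 - t * B a b) = Blinfun (edge_transport B t a b)"
proof -
  have "\<not> orth B (span {a}) (span {b})"
    unfolding orth_def using ab by (meson span_base singletonI)
  from null_dilation_unique[OF bilin sym quad this]
  have ex1: "\<exists>!f. is_null_dilation B (span {a}) (span {b}) (1 - t * B a b) f" .
  have "is_null_dilation B (span {a}) (span {b}) (1 - t * B a b) (Blinfun (edge_transport B t a b))"
    unfolding is_null_dilation_def blinfun_apply_edge_transport
  proof (intro conjI allI impI ballI)
    fix x assume "x \<in> span {b}"
    then obtain y where "x = y *\<^sub>R b" by (auto simp: span_singleton)
    then show "edge_transport B t a b x = (1 - t * B a b) *\<^sub>R x"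
      by (simp add: edge_transport_def form_simps null algebra_simps)
  next
    fix x assume "x \<in> span {a}"
    then obtain y where x: "x = y *\<^sub>R a" by (auto simp: span_singleton)
    have "1 + t / (1 - t * B a b) * B a b = 1 / (1 - t * B a b)"
      using r by (simp add: field_simps)
    moreover have "edge_transport B t a b x = (1 + t / (1 - t * B a b) * B a b) *\<^sub>R x"
      by (simp add: edge_transport_def x form_simps null sym[of b a] algebra_simps)
    ultimately show "edge_transport B t a b x = (1 / (1 - t * B a b)) *\<^sub>R x"
      by simp
  next
    fix x assume "\<forall>y\<in>span (span {a} \<union> span {b}). B x y = 0"
    then have "B x a = 0" "B x b = 0"
      by (meson Un_iff singletonI span_base)+
    then show "edge_transport B t a b x = x"
      by (simp add: edge_transport_def sym[of _ x])
  qed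
  then show ?thesis
    unfolding null_dilation_def using ex1 by (rule the1_equality[rotated])
qed

lemma blinfun_exp_square_zero:
  fixes A :: "'b::euclidean_space \<Rightarrow>\<^sub>L 'b"
  assumes "A o\<^sub>L A = 0"
  shows "blinfun_exp A = id_blinfun + A"
proof -
  have AA: "blinfun_apply A (blinfun_apply A x) = 0" for x
    using assms by (metis blinfun_apply_blinfun_compose zero_blinfun.rep_eq)
  have "((o\<^sub>L) A ^^ Suc (Suc k)) id_blinfun = 0" for k
    by (induction k) (auto intro!: blinfun_eqI simp: AA)
  moreover have "\<exists>k. n = Suc (Suc k)" if "n \<notin> {0, 1}" for n
    using that by (cases n rule: nat.exhaust; cases "n - 1" rule: nat.exhaust) auto
  ultimately have zero: "((o\<^sub>L) A ^^ n) id_blinfun = 0" if "n \<notin> {0, 1}" for n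
    using that by metis
  have "blinfun_exp A = (\<Sum>n\<in>{0, 1}. (1 / fact n) *\<^sub>R (((o\<^sub>L) A ^^ n) id_blinfun))"
    unfolding blinfun_exp_def by (rule suminf_finite) (use zero in auto)
  also have "\<dots> = id_blinfun + A"
    by (auto intro: blinfun_eqI)
  finally show ?thesis .
qed

lemma blinfun_exp_wedge_orthogonal:
  assumes null: "B a a = 0" "B b b = 0" and ab: "B a b = 0"
  shows "blinfun_exp (t *\<^sub>R wedge B b a) = Blinfun (edge_transport B t a b)"
proof -
  have "(t *\<^sub>R wedge B b a) o\<^sub>L (t *\<^sub>R wedge B b a) = 0"
    by (rule blinfun_eqI)
      (simp add: blinfun.scaleR_left blinfun_apply_wedge[OF bilin] form_simps null ab sym[of b a])
  then show ?thesis
    by (intro blinfun_eqI) (simp add: blinfun_exp_square_zero blinfun_apply_edge_transport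
        blinfun.add_left blinfun.scaleR_left blinfun_apply_wedge[OF bilin] edge_transport_def ab
        algebra_simps)
qed

lemma line_of_nonzero:
  assumes "L \<in> quadric B" "a \<in> L" "a \<noteq> 0"
  shows "L = span {a}" and "B a a = 0"
proof -
  obtain v where v: "L = span {v}" "B v v = 0"
    using assms(1) unfolding quadric_def light_cone_def by blast
  then obtain c where a: "a = c *\<^sub>R v" using assms(2) by (auto simp: span_singleton)
  then have "v = (1 / c) *\<^sub>R a" using assms(3) by auto
  then have "v \<in> span {a}" by (metis span_base span_scale singletonI)
  moreover have "a \<in> span {v}" using assms(2) v by simp
  ultimately show "L = span {a}"
    unfolding v(1) by (intro equalityI span_minimal subspace_span) auto
  show "B a a = 0" by (simp add: a form_simps v)
qed

text \<open>Any vectors \<open>a\<close> and \<open>b\<close> with \<open>\<eta> j i = wedge B b a\<close> will do, because the label depends only on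
  the bivector. This freedom is what allows a Moutard lift to be inserted on all four edges of
  a quadrilateral at once.\<close>

lemma isothermic_connection_apply:
  assumes net: "isothermic_net B S s \<eta>" and lab: "edge_labelling B S s \<eta> m"
    and e: "edge S i j" and t: "ereal t \<noteq> m i j"
    and a: "a \<in> s i" and b: "b \<in> s j" and \<eta>: "\<eta> j i = wedge B b a"
  shows "1 - t * B a b \<noteq> 0"
    and "blinfun_apply (isothermic_connection B s \<eta> m t j i) = edge_transport B t a b"
proof -
  have Q: "s i \<in> quadric B" "s j \<in> quadric B" and nz: "wedge B b a \<noteq> 0"
    using net e \<eta> unfolding isothermic_net_def regular_net_def edge_def by auto
  obtain a' b' where "a' \<in> s i" "b' \<in> s j" "\<eta> j i = wedge B b' a'" "m i j = 1 / ereal (B a' b')"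
    using lab e unfolding edge_labelling_def by blast
  with edge_label_unique[OF bilin Q a _ b _ _ nz] \<eta> have m: "m i j = 1 / ereal (B a b)"
    by metis
  have "a \<noteq> 0" "b \<noteq> 0"
    using nz wedge_scale[OF bilin, of 1 b 0 a] wedge_scale[OF bilin, of 0 b 1 a] by auto
  note line_a = line_of_nonzero[OF Q(1) a \<open>a \<noteq> 0\<close>] and line_b = line_of_nonzero[OF Q(2) b \<open>b \<noteq> 0\<close>]
  show r: "1 - t * B a b \<noteq> 0"
  proof (cases "B a b = 0")
    case False
    then have "m i j = ereal (1 / B a b)" by (simp add: m one_ereal_def)
    with t False show ?thesis by (auto simp: field_simps)
  qed simp
  have "isothermic_connection B s \<eta> m t j i = Blinfun (edge_transport B t a b)"
  proof (cases "B a b = 0")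
    case True
    then have "m i j = \<infinity>" by (simp add: m)
    then show ?thesis
      using blinfun_exp_wedge_orthogonal[OF line_a(2) line_b(2) True]
      by (simp add: isothermic_connection_def \<eta>)
  next
    case False
    then have "m i j = ereal (1 / B a b)" by (simp add: m one_ereal_def)
    then show ?thesis
      using null_dilation_eq_edge_transport[OF _ _ line_a(2) line_b(2) False r] Q
      unfolding isothermic_connection_def line_a(1) line_b(1) by simp
  qed
  then show "blinfun_apply (isothermic_connection B s \<eta> m t j i) = edge_transport B t a b"
    by (simp add: blinfun_apply_edge_transport)
qed


section \<open>Moutard lifts\<close>

lemma in_span_of_scaled:
  fixes x :: "'b::real_vector"
  assumes "c *\<^sub>R x \<in> span T" "c \<noteq> 0"
  shows "x \<in> span T"
  using span_scale[OF assms(1), of "1 / c"] assms(2) by simp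

text \<open>A bivector \<open>v \<and> w\<close>, seen as an endomorphism, takes its values in the plane of any of its
  representations. So it suffices to recover \<open>v\<close> and \<open>w\<close> from such values; as arguments serve
  \<open>v\<close> and \<open>w\<close> themselves and a vector \<open>u\<close> that is not orthogonal to \<open>v\<close>.\<close>

lemma wedge_eq_imp_in_span:
  assumes eq: "wedge B v w = wedge B v' w'"
    and v: "B v v = 0" and w: "B w w \<noteq> 0" and u: "B v u \<noteq> 0"
  shows "v \<in> span {v', w'}" and "w \<in> span {v', w'}"
proof -
  let ?P = "span {v', w'}"
  have val: "B v z *\<^sub>R w - B w z *\<^sub>R v \<in> ?P" for z
  proof -
    have "B v z *\<^sub>R w - B w z *\<^sub>R v = B v' z *\<^sub>R w' - B w' z *\<^sub>R v'"
      using eq by (metis blinfun_apply_wedge[OF bilin])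
    then show ?thesis by (simp add: span_base span_diff span_scale)
  qed
  \<comment> \<open>The argument \<open>v\<close> recovers \<open>v\<close> unless \<open>v\<close> and \<open>w\<close> are orthogonal, and then \<open>w\<close> does.\<close>
  show v_in: "v \<in> ?P"
  proof (cases "B w v = 0")
    case True
    then have "- B w w *\<^sub>R v \<in> ?P"
      using val[of w] sym[of v w] by simp
    then show ?thesis using w in_span_of_scaled by fastforce
  next
    case False
    have "- B w v *\<^sub>R v \<in> ?P" using val[of v] v by simp
    then show ?thesis using False in_span_of_scaled by fastforce
  qed
  have "(B v u *\<^sub>R w - B w u *\<^sub>R v) + B w u *\<^sub>R v \<in> ?P"
    using val v_in by (intro span_add span_scale)
  then have "B v u *\<^sub>R w \<in> ?P" by simp
  then show "w \<in> ?P" using u by (rule in_span_of_scaled)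
qed

text \<open>The assumption \<open>closed\<close> is closedness on one quadrilateral, in terms of generators of the four
  lines. It equates two decomposable bivectors, one containing \<open>vj\<close> and one containing \<open>vl\<close>, whose
  other factors are combinations of \<open>vi\<close> and \<open>vk\<close>. The conclusion says that
  \<open>\<alpha> *\<^sub>R vi\<close>, \<open>vj\<close>, \<open>\<beta> *\<^sub>R vk\<close>, \<open>\<nu> *\<^sub>R vl\<close> is a Moutard lift that represents the form on all
  four edges.\<close>

lemma moutard_lift:
  assumes null: "B vi vi = 0" "B vj vj = 0" "B vk vk = 0" "B vl vl = 0"
    and ik: "B vi vk \<noteq> 0" and jl: "B vj vl \<noteq> 0"
    and dim: "dim {vi, vj, vk, vl} \<ge> 3"
    and nz: "\<alpha> \<noteq> 0" "\<beta> \<noteq> 0"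
    and closed: "\<delta> *\<^sub>R wedge B vi vl + \<gamma> *\<^sub>R wedge B vl vk + \<beta> *\<^sub>R wedge B vk vj + \<alpha> *\<^sub>R wedge B vj vi = 0"
  obtains \<nu> \<kappa> where "\<delta> = \<nu> * \<alpha>" "\<gamma> = \<nu> * \<beta>"
    "vj - \<nu> *\<^sub>R vl = \<kappa> *\<^sub>R (\<alpha> *\<^sub>R vi - \<beta> *\<^sub>R vk)"
proof -
  define w where "w = \<alpha> *\<^sub>R vi - \<beta> *\<^sub>R vk"
  define w' where "w' = \<delta> *\<^sub>R vi - \<gamma> *\<^sub>R vk"
  have eq: "wedge B vj w = wedge B vl w'"
  proof (rule blinfun_eqI)
    fix z
    from closed have "blinfun_apply (\<delta> *\<^sub>R wedge B vi vl + \<gamma> *\<^sub>R wedge B vl vk + \<beta> *\<^sub>R wedge B vk vj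
        + \<alpha> *\<^sub>R wedge B vj vi) z = 0" by simp
    then show "blinfun_apply (wedge B vj w) z = blinfun_apply (wedge B vl w') z"
      by (simp add: blinfun.add_left blinfun.scaleR_left blinfun_apply_wedge[OF bilin] w_def w'_def
          form_simps algebra_simps)
  qed
  have ww: "B w w \<noteq> 0"
    using ik nz by (simp add: w_def form_simps null sym[of vk vi])
  note inP = wedge_eq_imp_in_span[OF eq null(2) ww jl]
  have det: "\<alpha> * \<gamma> = \<beta> * \<delta>"
  proof (rule ccontr)
    \<comment> \<open>Otherwise \<open>w\<close> and \<open>w'\<close> span \<open>vi\<close> and \<open>vk\<close>, so all four lines lie in one plane.\<close>
    assume neq: "\<alpha> * \<gamma> \<noteq> \<beta> * \<delta>"
    let ?P = "span {vl, w'}"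
    have w': "w' \<in> ?P" and vl: "vl \<in> ?P" by (simp_all add: span_base)
    have "\<gamma> *\<^sub>R w - \<beta> *\<^sub>R w' \<in> ?P" "\<delta> *\<^sub>R w - \<alpha> *\<^sub>R w' \<in> ?P"
      using inP w' by (auto intro: span_diff span_scale)
    moreover have "\<gamma> *\<^sub>R w - \<beta> *\<^sub>R w' = (\<alpha> * \<gamma> - \<beta> * \<delta>) *\<^sub>R vi"
      and "\<delta> *\<^sub>R w - \<alpha> *\<^sub>R w' = (\<alpha> * \<gamma> - \<beta> * \<delta>) *\<^sub>R vk"
      by (simp_all add: w_def w'_def algebra_simps)
    ultimately have "vi \<in> ?P" "vk \<in> ?P"
      using neq in_span_of_scaled[of "\<alpha> * \<gamma> - \<beta> * \<delta>"] by auto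
    then have "dim {vi, vj, vk, vl} \<le> card {vl, w'}"
      using inP vl by (intro dim_le_card) auto
    also have "\<dots> \<le> 2" by (simp add: card_insert_if)
    finally show False using dim by simp
  qed
  define \<nu> where "\<nu> = \<delta> / \<alpha>"
  have \<delta>: "\<delta> = \<nu> * \<alpha>" and \<gamma>: "\<gamma> = \<nu> * \<beta>"
    using det nz by (simp_all add: \<nu>_def field_simps)
  have w': "w' = \<nu> *\<^sub>R w"
    by (simp add: w_def w'_def \<delta> \<gamma> algebra_simps)
  have "vj \<in> span {vl, w'}" by (rule inP)
  then obtain x y where "vj = x *\<^sub>R vl + y *\<^sub>R w'"
    by (force simp: span_insert span_singleton algebra_simps)
  then have vj: "vj = x *\<^sub>R vl + (y * \<nu>) *\<^sub>R w"
    by (simp add: w')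
  have "x = \<nu>"
  proof (rule ccontr)
    assume "x \<noteq> \<nu>"
    \<comment> \<open>Then \<open>vl \<and> w = 0\<close>, and evaluating at \<open>vj\<close> makes \<open>w\<close> a multiple of the null vector \<open>vl\<close>.\<close>
    have "blinfun_apply (wedge B vj w) vj = blinfun_apply (wedge B vl w') vj"
      by (simp only: eq)
    then have "(x - \<nu>) *\<^sub>R (B vl vj *\<^sub>R w - B w vj *\<^sub>R vl) = 0"
      by (simp add: blinfun_apply_wedge[OF bilin] w' vj form_simps algebra_simps)
    then have vl_w: "B vl vj *\<^sub>R w = B w vj *\<^sub>R vl"
      using \<open>x \<noteq> \<nu>\<close> by simp
    have "B vl vj \<noteq> 0" using jl sym[of vj vl] by simp
    then have "w = (B w vj / B vl vj) *\<^sub>R vl"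
      using arg_cong[OF vl_w, of "\<lambda>z. (1 / B vl vj) *\<^sub>R z"] by simp
    from arg_cong2[OF this this, of B] have "B w w = 0"
      by (simp add: form_simps null)
    with ww show False by simp
  qed
  then have "vj - \<nu> *\<^sub>R vl = (y * \<nu>) *\<^sub>R (\<alpha> *\<^sub>R vi - \<beta> *\<^sub>R vk)"
    using vj by (simp add: w_def)
  with \<delta> \<gamma> show ?thesis by (rule that)
qed

end


section \<open>Flatness\<close>

lemma edge_sym: "edge S i j \<Longrightarrow> edge S j i"
  unfolding edge_def unit_step_def by (metis minus_diff_eq minus_minus)

lemma quad_edges:
  assumes "quad S i j k l"
  shows "edge S i j" "edge S j k" "edge S i l" "edge S l k"
  using assms unfolding quad_def edge_def by (auto simp: algebra_simps)

theorem proposition4p16: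
  fixes B :: "'a::euclidean_space \<Rightarrow> 'a \<Rightarrow> real"
    and p q :: nat
    and S :: "(int ^ 'n) set"
    and s :: "int ^ 'n \<Rightarrow> 'a set"
    and \<eta> :: "int ^ 'n \<Rightarrow> int ^ 'n \<Rightarrow> 'a \<Rightarrow>\<^sub>L 'a"
    and m :: "int ^ 'n \<Rightarrow> int ^ 'n \<Rightarrow> ereal"
    and t :: real
  assumes "form_of_signature B (p + 1) (q + 1)"
    and "isothermic_net B S s \<eta>"
    and "edge_labelling B S s \<eta> m"
    and "\<And>i j. edge S i j \<Longrightarrow> ereal t \<noteq> m i j"
  shows "flat_connection S (isothermic_connection B s \<eta> m t)"
proof -
  interpret symmetric_bilinear_form B
    using assms(1) unfolding form_of_signature_def by unfold_locales auto
  note apply_edge = isothermic_connection_apply[OF assms(2,3) _ assms(4)]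
  have \<eta>_sym: "\<eta> i j = - \<eta> j i" if "edge S i j" for i j
    using assms(2) edge_sym[OF that] unfolding isothermic_net_def one_form_def by blast
  have wedge_swap: "wedge B x y = - wedge B y x" for x y
    by (rule blinfun_eqI) (simp add: blinfun.minus_left blinfun_apply_wedge[OF bilin])
  have generator: "\<exists>v. s i = span {v} \<and> B v v = 0" if "i \<in> S" for i
    using assms(2) that
    unfolding isothermic_net_def regular_net_def quadric_def light_cone_def by fastforce
  have scaled: "\<exists>c. c \<noteq> 0 \<and> \<eta> j i = c *\<^sub>R wedge B v u"
    if e: "edge S i j" and u: "s i = span {u}" and v: "s j = span {v}" for i j u v
  proof -
    obtain a b where "a \<in> s i" "b \<in> s j" "\<eta> j i = wedge B b a"
      using assms(3) e unfolding edge_labelling_def by blast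
    then have "\<exists>c. \<eta> j i = c *\<^sub>R wedge B v u"
      by (auto simp: u v span_singleton wedge_scale[OF bilin] intro: exI[of _ "_ * _"])
    then obtain c where c: "\<eta> j i = c *\<^sub>R wedge B v u" ..
    have "\<eta> j i \<noteq> 0" using assms(2) e unfolding isothermic_net_def by blast
    with c show ?thesis by auto
  qed

  have "isothermic_connection B s \<eta> m t i j o\<^sub>L isothermic_connection B s \<eta> m t j i = id_blinfun"
    if e: "edge S i j" for i j
  proof -
    obtain a b where ab: "a \<in> s i" "b \<in> s j" "\<eta> j i = wedge B b a"
      using assms(3) e unfolding edge_labelling_def by blast
    have ba: "\<eta> i j = wedge B a b"
      using \<eta>_sym[OF e] ab(3) wedge_swap by metis
    have "i \<in> S" "j \<in> S" using e by (auto simp: edge_def)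
    then have "B a a = 0" "B b b = 0"
      using ab generator by (fastforce simp: span_singleton form_simps)+
    from edge_transport_inverse[OF this apply_edge(1)[OF e e ab]]
    show ?thesis
      using apply_edge(2)[OF e e ab] apply_edge(2)[OF edge_sym[OF e] edge_sym[OF e] ab(2,1) ba]
      by (intro blinfun_eqI) simp
  qed
  moreover have "isothermic_connection B s \<eta> m t k j o\<^sub>L isothermic_connection B s \<eta> m t j i
      = isothermic_connection B s \<eta> m t k l o\<^sub>L isothermic_connection B s \<eta> m t l i"
    if Q: "quad S i j k l" for i j k l
  proof -
    note e = quad_edges[OF Q]
    obtain vi vj vk vl where v: "s i = span {vi}" "s j = span {vj}" "s k = span {vk}" "s l = span {vl}"
      and null: "B vi vi = 0" "B vj vj = 0" "B vk vk = 0" "B vl vl = 0"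
      using Q generator unfolding quad_def by meson
    obtain \<alpha> where \<alpha>: "\<alpha> \<noteq> 0" "\<eta> j i = \<alpha> *\<^sub>R wedge B vj vi"
      using scaled[OF e(1) v(1,2)] by blast
    obtain \<beta> where \<beta>: "\<beta> \<noteq> 0" "\<eta> k j = \<beta> *\<^sub>R wedge B vk vj"
      using scaled[OF e(2) v(2,3)] by blast
    obtain \<gamma> where \<gamma>: "\<eta> l k = \<gamma> *\<^sub>R wedge B vl vk"
      using scaled[OF edge_sym[OF e(4)] v(3,4)] by blast
    obtain \<delta> where \<delta>: "\<eta> i l = \<delta> *\<^sub>R wedge B vi vl"
      using scaled[OF edge_sym[OF e(3)] v(4,1)] by blast
    have reg: "dim (span (s i \<union> s j \<union> s k \<union> s l)) \<ge> 3" "\<not> orth B (s i) (s k)" "\<not> orth B (s j) (s l)"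
      using assms(2) Q unfolding isothermic_net_def regular_net_def by blast+
    have "s i \<union> s j \<union> s k \<union> s l \<subseteq> span {vi, vj, vk, vl}"
      unfolding v by (intro Un_least span_mono) auto
    then have "dim (s i \<union> s j \<union> s k \<union> s l) \<le> dim {vi, vj, vk, vl}"
      by (metis dim_span dim_subset)
    then have dim: "dim {vi, vj, vk, vl} \<ge> 3"
      using reg(1) by simp
    have orth: "B vi vk \<noteq> 0" "B vj vl \<noteq> 0"
      using reg(2,3) unfolding orth_def v by (auto simp: span_singleton form_simps)
    have "\<eta> i l + \<eta> l k + \<eta> k j + \<eta> j i = 0"
      using assms(2) Q unfolding isothermic_net_def closed_form_def by blast
    then have closed: "\<delta> *\<^sub>R wedge B vi vl + \<gamma> *\<^sub>R wedge B vl vk + \<beta> *\<^sub>R wedge B vk vj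
        + \<alpha> *\<^sub>R wedge B vj vi = 0"
      by (simp only: \<alpha> \<beta> \<gamma> \<delta>)
    obtain \<nu> \<kappa> where lift: "\<delta> = \<nu> * \<alpha>" "\<gamma> = \<nu> * \<beta>"
        "vj - \<nu> *\<^sub>R vl = \<kappa> *\<^sub>R (\<alpha> *\<^sub>R vi - \<beta> *\<^sub>R vk)"
      by (rule moutard_lift[OF null orth dim \<alpha>(1) \<beta>(1) closed])
    let ?a = "\<alpha> *\<^sub>R vi" and ?c = "\<beta> *\<^sub>R vk" and ?d = "\<nu> *\<^sub>R vl"
    have mem: "?a \<in> s i" "vj \<in> s j" "?c \<in> s k" "?d \<in> s l"
      by (auto simp: v span_base span_scale)
    have \<eta>_ji: "\<eta> j i = wedge B vj ?a"
      using wedge_scale[OF bilin, of 1 vj \<alpha> vi] \<alpha> by simp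
    have \<eta>_kj: "\<eta> k j = wedge B ?c vj"
      using wedge_scale[OF bilin, of \<beta> vk 1 vj] \<beta> by simp
    have "\<eta> l k = wedge B ?d ?c" "\<eta> i l = wedge B ?a ?d"
      by (simp_all add: wedge_scale[OF bilin] \<gamma> \<delta> lift mult.commute)
    then have \<eta>_kl: "\<eta> k l = wedge B ?c ?d" and \<eta>_li: "\<eta> l i = wedge B ?d ?a"
      using \<eta>_sym[OF e(4)] \<eta>_sym[OF e(3)] \<eta>_sym[OF edge_sym[OF e(4)]] \<eta>_sym[OF edge_sym[OF e(3)]] wedge_swap by metis+
    note ji = apply_edge[OF e(1) e(1) mem(1,2) \<eta>_ji] and kj = apply_edge[OF e(2) e(2) mem(2,3) \<eta>_kj]
      and kl = apply_edge[OF e(4) e(4) mem(4,3) \<eta>_kl] and li = apply_edge[OF e(3) e(3) mem(1,4) \<eta>_li]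
    have "edge_transport B t vj ?c (edge_transport B t ?a vj x)
        = edge_transport B t ?d ?c (edge_transport B t ?a ?d x)" for x
      by (rule edge_transport_flat[OF _ _ _ _ lift(3) ji(1) kj(1)]) (simp_all add: form_simps null)
    then show ?thesis
      by (intro blinfun_eqI) (simp add: ji(2) kj(2) kl(2) li(2))
  qed
  ultimately show ?thesis
    unfolding flat_connection_def connection_def by blast
qed

end
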